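(* Let $f=(f_1,\dots,f_n):\mathbb{C}^n\to\mathbb{C}^n$ be a real square polynomial system, i.e. $\{\overline{f_1},\dots,\overline{f_n}\}=\{f_1,\dots,f_n\}$. Let $x\in\mathbb{C}^n$ be an approximate solution to $f$ with associated solution $\xi$, and let $\pi_{\mathbb{R}}(x):=\frac{x+\overline{x}}{2}\in\mathbb{R}^n$. (1) If $\|x-\pi_{\mathbb{R}}(x)\|>2\beta(f,x)$, then $\xi$ is not real, i.e. $\xi\notin\mathbb{R}^n$. (2) If $\alpha(f,x)<0.03$ and $\|x-\pi_{\mathbb{R}}(x)\|<\frac{1}{20\,\gamma(f,x)}$, then $\pi_{\mathbb{R}}(x)$ is also an approximate solution to $f$ with associated solution $\xi$, and $\xi\in\mathbb{R}^n$.
   Context: The norm on $\mathbb{C}^n$ is the usual hermitian norm, and $\overline{x}$ is the coordinatewise complex conjugate. For a polynomial $f_i$, $\overline{f_i}$ is the polynomial obtained by conjugating its coefficients. $\mathcal{V}(f)$ is the set of $\xi\in\mathbb{C}^n$ with $f(\xi)=0$. For a square polynomial system $f:\mathbb{C}^n\to\mathbb{C}^n$ with Jacobian matrix $Df(x)$, the Newton map is $N_f(x):=x-Df(x)^{-1}f(x)$ if $Df(x)$ is invertible and $N_f(x):=x$ otherwise; $N_f^k$ is its $k$-fold iterate. A point $x\in\mathbb{C}^n$ is an approximate solution to $f$ with associated solution $\xi\in\mathcal{V}(f)$ if for every $k\in\mathbb{N}$, $\|N_f^k(x)-\xi\|\le(1/2)^{2^k-1}\|x-\xi\|$. If $Df(x)$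 is invertible, define $\beta(f,x):=\|Df(x)^{-1}f(x)\|$, $\gamma(f,x):=\sup_{k\ge2}\left\|\frac{Df(x)^{-1}D^kf(x)}{k!}\right\|^{1/(k-1)}$, and $\alpha(f,x):=\beta(f,x)\gamma(f,x)$. Here $D^kf(x)$ is the $k$-th derivative, the symmetric tensor of order-$k$ partial derivatives, viewed as a linear map $S^k\mathbb{C}^n\to\mathbb{C}^n$ from the $k$-fold symmetric power. The norm is the operator norm with respect to the hermitian norm on $\mathbb{C}^n$ and the norm on $S^k\mathbb{C}^n$ dual to the unitarily invariant norm on homogeneous polynomials of degree $k$ in $n$ variables, $\|\sum_{|\nu|=k}a_\nu x^\nu\|^2:=\sum_{|\nu|=k}|a_\nu|^2/\binom{k}{\nu}$ with $\binom{k}{\nu}=\frac{k!}{\nu_1!\cdots\nu_n!}$ (where $S^k\mathbb{C}^n$ is identified with the dual of this space of polynomials so that $v^k$ acts by evaluation $p\mapsto p(v)$). If $f(x)=0$ and $Df(x)$ is not invertible, then $\alpha(f,x):=\beta(f,x):=0$ and $\gamma(f,x):=\infty$. If $f(x)\ne0$ and $Df(x)$ is not invertible, then $\alpha(f,x):=\beta(f,x):=\gamma(f,x):=\infty$. Conventions: $1/\infty=0$ and $1/0=+\infty$. *)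

theory Defs
  imports "HOL-Analysis.Analysis" "HOL-Library.Poly_Mapping"
begin

section \<open>Polynomials and square polynomial systems\<close>

text \<open>A polynomial in the variables indexed by the finite type \<open>'n\<close> is a finitely supported map
  from exponent vectors to coefficients; ring structure from \<^theory>\<open>HOL-Library.Poly_Mapping\<close>.\<close>

type_synonym 'n cpoly = "('n \<Rightarrow>\<^sub>0 nat) \<Rightarrow>\<^sub>0 complex"

type_synonym 'n polysys = "('n cpoly)^'n"

definition eval_poly :: "'n::finite cpoly \<Rightarrow> complex^'n \<Rightarrow> complex" where
  "eval_poly p x =
     (\<Sum>m\<in>Poly_Mapping.keys p. Poly_Mapping.lookup p m * (\<Prod>i\<in>UNIV. (x $ i) ^ Poly_Mapping.lookup m i))"

definition eval_sys :: "'n::finite polysys \<Rightarrow> complex^'n \<Rightarrow> complex^'n" where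
  "eval_sys f x = (\<chi> i. eval_poly (f $ i) x)"

definition zero_set :: "'n::finite polysys \<Rightarrow> (complex^'n) set" where
  "zero_set f = {\<xi>. eval_sys f \<xi> = 0}"

definition cnj_poly :: "'n cpoly \<Rightarrow> 'n cpoly" where
  "cnj_poly p = Poly_Mapping.map cnj p"

definition real_sys :: "'n::finite polysys \<Rightarrow> bool" where
  "real_sys f \<longleftrightarrow> range (\<lambda>i. cnj_poly (f $ i)) = range (\<lambda>i. f $ i)"

definition real_points :: "(complex^'n::finite) set" where
  "real_points = {x. \<forall>i. x $ i \<in> \<real>}"

definition cnj_vec :: "complex^'n::finite \<Rightarrow> complex^'n" where
  "cnj_vec x = (\<chi> i. cnj (x $ i))"

definition proj_real :: "complex^'n::finite \<Rightarrow> complex^'n" where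
  "proj_real x = (1/2) *s (x + cnj_vec x)"


section \<open>Derivatives and Newton's method\<close>

text \<open>For a monomial not involving the variable \<open>i\<close> the summand below is \<open>0\<close>, so the truncated
  subtraction on exponents is harmless.\<close>

definition partial :: "'n \<Rightarrow> 'n cpoly \<Rightarrow> 'n cpoly" where
  "partial i p =
     (\<Sum>m\<in>Poly_Mapping.keys p.
        Poly_Mapping.single (m - Poly_Mapping.single i 1)
          (of_nat (Poly_Mapping.lookup m i) * Poly_Mapping.lookup p m))"

definition jacobian :: "'n::finite polysys \<Rightarrow> complex^'n \<Rightarrow> complex^'n^'n" where
  "jacobian f x = (\<chi> i j. eval_poly (partial j (f $ i)) x)"

definition newton :: "'n::finite polysys \<Rightarrow> complex^'n \<Rightarrow> complex^'n" where
  "newton f x =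
     (if invertible (jacobian f x) then x - matrix_inv (jacobian f x) *v eval_sys f x else x)"

definition approx_solution :: "'n::finite polysys \<Rightarrow> complex^'n \<Rightarrow> complex^'n \<Rightarrow> bool" where
  "approx_solution f x \<xi> \<longleftrightarrow>
     \<xi> \<in> zero_set f \<and>
     (\<forall>k::nat. norm ((newton f ^^ k) x - \<xi>) \<le> (1/2) ^ (2 ^ k - 1) * norm (x - \<xi>))"


section \<open>The unitarily invariant norm and symmetric powers\<close>

definition hom_polys :: "nat \<Rightarrow> 'n::finite cpoly set" where
  "hom_polys k = {p. \<forall>m\<in>Poly_Mapping.keys p. (\<Sum>i\<in>UNIV. Poly_Mapping.lookup m i) = k}"

definition multinomial :: "nat \<Rightarrow> ('n::finite \<Rightarrow>\<^sub>0 nat) \<Rightarrow> real" where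
  "multinomial k \<nu> = fact k / (\<Prod>i\<in>UNIV. fact (Poly_Mapping.lookup \<nu> i))"

definition hom_norm :: "nat \<Rightarrow> 'n::finite cpoly \<Rightarrow> real" where
  "hom_norm k p =
     sqrt (\<Sum>\<nu>\<in>Poly_Mapping.keys p. (cmod (Poly_Mapping.lookup p \<nu>))\<^sup>2 / multinomial k \<nu>)"

text \<open>The symmetric power \<open>S\<^sup>k \<complex>\<^sup>n\<close> is the space of linear functionals on the homogeneous polynomials of
  degree \<open>k\<close>, where \<open>v\<^sup>k\<close> is the functional \<open>\<lambda>p. eval_poly p v\<close>. Only the values of a
  functional on \<^term>\<open>hom_polys k\<close> matter. The suprema below are over unit balls of
  finite-dimensional spaces, hence of bounded nonempty sets.\<close>

definition sym_power :: "nat \<Rightarrow> ('n::finite cpoly \<Rightarrow> complex) set" where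
  "sym_power k =
     {L. (\<forall>p\<in>hom_polys k. \<forall>q\<in>hom_polys k. L (p + q) = L p + L q) \<and>
         (\<forall>c. \<forall>p\<in>hom_polys k. L (Poly_Mapping.map (\<lambda>a. c * a) p) = c * L p)}"

definition sym_norm :: "nat \<Rightarrow> ('n::finite cpoly \<Rightarrow> complex) \<Rightarrow> real" where
  "sym_norm k L = (SUP p\<in>{p \<in> hom_polys k. hom_norm k p \<le> 1}. cmod (L p))"

definition sym_onorm :: "nat \<Rightarrow> (('n::finite cpoly \<Rightarrow> complex) \<Rightarrow> complex^'n) \<Rightarrow> real" where
  "sym_onorm k T = (SUP L\<in>{L \<in> sym_power k. sym_norm k L \<le> 1}. norm (T L))"

text \<open>The list \<open>[i\<^sub>1, \<dots>, i\<^sub>k]\<close> indexes the tensor entry \<open>\<partial>\<^sub>i\<^sub>1 \<dots> \<partial>\<^sub>i\<^sub>k f(x)\<close>; the corresponding tensor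
  coordinate of a functional \<open>L\<close> is its value on the monomial \<open>x\<^sub>i\<^sub>1 \<dots> x\<^sub>i\<^sub>k\<close>. On \<open>v\<^sup>k\<close> this gives
  the \<open>k\<close>-th directional derivative \<open>D\<^sup>k f(x)(v, \<dots>, v)\<close>.\<close>

definition monom_of :: "'n list \<Rightarrow> 'n cpoly" where
  "monom_of is = Poly_Mapping.single (\<Sum>i\<leftarrow>is. Poly_Mapping.single i 1) 1"

definition deriv_tensor ::
    "'n::finite polysys \<Rightarrow> nat \<Rightarrow> complex^'n \<Rightarrow> ('n cpoly \<Rightarrow> complex) \<Rightarrow> complex^'n" where
  "deriv_tensor f k x L =
     (\<chi> j. \<Sum>is | length is = k. eval_poly (foldr partial is (f $ j)) x * L (monom_of is))"


section \<open>Smale's invariants\<close>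

definition beta :: "'n::finite polysys \<Rightarrow> complex^'n \<Rightarrow> ennreal" where
  "beta f x =
     (if invertible (jacobian f x) then ennreal (norm (matrix_inv (jacobian f x) *v eval_sys f x))
      else if eval_sys f x = 0 then 0 else \<infinity>)"

definition gamma :: "'n::finite polysys \<Rightarrow> complex^'n \<Rightarrow> ennreal" where
  "gamma f x =
     (if invertible (jacobian f x) then
        (SUP k\<in>{2..}. ennreal (root (k - 1)
           (sym_onorm k (\<lambda>L. (1 / fact k) *s (matrix_inv (jacobian f x) *v deriv_tensor f k x L)))))
      else \<infinity>)"

definition alpha :: "'n::finite polysys \<Rightarrow> complex^'n \<Rightarrow> ennreal" where
  "alpha f x =
     (if invertible (jacobian f x) then beta f x * gamma f x
      else if eval_sys f x = 0 then 0 else \<infinity>)"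

end

(* Write A for the inverse of Df(x). The k-fold symmetric product of vectors has dual norm at most the
   product of their norms (Cauchy-Schwarz for symmetric tensors), so gamma bounds every
   A D^k f(x)(v_1, ..., v_k). Taylor expansion at x then bounds A D^2 f on the ball
   gamma ||z - x|| <= 0.17, and the mean value theorem makes A Df(z) close to the identity and Newton's
   method quadratically convergent to any zero in that ball. The hypotheses already provide the
   zero xi, at distance at most 2 beta from x, so no existence argument is needed. The conjugate of
   xi is also a zero near x and a fixed point of Newton's method; quadratic contraction forces it to
   coincide with xi. *)
theory Submission
  imports Defs "HOL-Combinatorics.Multiset_Permutations"
begin

text \<open>The obstacle is that \<open>gamma\<close> is a supremum over functionals on homogeneous
  polynomials, weighted by exponent vectors, while calculus produces multilinear forms in distinct
  directions: expanding a second derivative at \<open>x\<close> mixes the displacement with two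
  arbitrary vectors. Words of length k mediate. A polynomial becomes a symmetric tensor indexed by
  words, and since a fibre of words over one exponent vector has multinomial size, the weights of
  \<open>hom_norm\<close> become plain sums of squares. Constants, with distances multiplied by
  gamma: the hypotheses put \<xi> within 0.06 = 2 * 0.03 and the projection within 0.05 = 1/20 of
  \<open>x\<close>, hence at most 0.11 apart. Newton iterates get no farther from \<xi>, so they
  stay within 0.17 = 0.11 + 0.06 of \<open>x\<close>. There the second derivative is bounded by 2 /
  0.83^3 < 3.5. Half of this, 1.75, controls the Newton error, and 0.405 = 1 - 3.5 * 0.17 is what
  remains of the identity. Convergence rests on 1.75 * 0.11 < 0.405 / 2, uniqueness on 1.75 * 0.22 <
  0.405.\<close>

section \<open>Evaluation and partial derivatives of polynomials\<close>

definition eval_monom :: "('n::finite \<Rightarrow>\<^sub>0 nat) \<Rightarrow> complex^'n \<Rightarrow> complex" where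
  "eval_monom m x = (\<Prod>i\<in>UNIV. (x $ i) ^ Poly_Mapping.lookup m i)"

lemma eval_poly_superset:
  assumes "finite A" and "Poly_Mapping.keys p \<subseteq> A"
  shows "eval_poly p x = (\<Sum>m\<in>A. Poly_Mapping.lookup p m * eval_monom m x)"
  unfolding eval_poly_def eval_monom_def
  by (rule sum.mono_neutral_left) (use assms in \<open>auto simp: in_keys_iff\<close>)

lemma eval_poly_0 [simp]: "eval_poly 0 x = 0"
  by (simp add: eval_poly_def)

lemma eval_poly_add: "eval_poly (p + q) x = eval_poly p x + eval_poly q x"
proof -
  let ?A = "Poly_Mapping.keys p \<union> Poly_Mapping.keys q"
  have "Poly_Mapping.keys (p + q) \<subseteq> ?A"
    by (rule Poly_Mapping.keys_add)
  then show ?thesis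
    by (simp add: eval_poly_superset[of ?A] lookup_add distrib_right sum.distrib)
qed

lemma eval_poly_sum: "eval_poly (sum g A) x = (\<Sum>a\<in>A. eval_poly (g a) x)"
  by (induction A rule: infinite_finite_induct) (auto simp: eval_poly_add)

lemma eval_poly_single: "eval_poly (Poly_Mapping.single m c) x = c * eval_monom m x"
  by (subst eval_poly_superset[of "{m}"]) auto

lemma lookup_partial:
  "Poly_Mapping.lookup (partial i p) m =
     of_nat (Poly_Mapping.lookup m i + 1) * Poly_Mapping.lookup p (m + Poly_Mapping.single i 1)"
proof -
  let ?e = "Poly_Mapping.single i (1::nat)"
  \<comment> \<open>Truncated subtraction merges exponents only when the exponent of
    \<open>i\<close> is 0, and then the factor \<open>of_nat 0\<close> removes the summand. So a
    single monomial of \<open>p\<close> contributes.\<close>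
  have shift: "m' = m + ?e"
    if "m' - ?e = m" "Poly_Mapping.lookup m' i \<noteq> 0" for m'
  proof (rule poly_mapping_eqI)
    fix j
    have "Poly_Mapping.lookup (m' - ?e) j = Poly_Mapping.lookup m j"
      using that by simp
    then show "Poly_Mapping.lookup m' j = Poly_Mapping.lookup (m + ?e) j"
      using that(2) by (auto simp: lookup_add lookup_minus lookup_single when_def split: if_splits)
  qed
  have "Poly_Mapping.lookup (partial i p) m =
    (\<Sum>m'\<in>Poly_Mapping.keys p. if m' = m + ?e
      then of_nat (Poly_Mapping.lookup m i + 1) * Poly_Mapping.lookup p (m + ?e) else 0)"
    unfolding partial_def lookup_sum
  proof (rule sum.cong[OF refl])
    fix m'
    show "Poly_Mapping.lookup (Poly_Mapping.single (m' - ?e)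
        (of_nat (Poly_Mapping.lookup m' i) * Poly_Mapping.lookup p m')) m =
      (if m' = m + ?e then of_nat (Poly_Mapping.lookup m i + 1) *
         Poly_Mapping.lookup p (m + ?e) else 0)"
    proof (cases "m' = m + ?e")
      case True
      then show ?thesis by (simp add: lookup_add)
    next
      case False
      then have "m' - ?e \<noteq> m \<or> Poly_Mapping.lookup m' i = 0"
        using shift by blast
      with False show ?thesis by (auto simp: lookup_single)
    qed
  qed
  then show ?thesis
    by (auto simp: in_keys_iff)
qed

lemma partial_commute: "partial i (partial j p) = partial j (partial i p)"
  by (rule poly_mapping_eqI, cases "i = j")
    (auto simp: lookup_partial lookup_add lookup_single when_def add_ac)

lemma foldr_partial_permute:
  assumes "mset is = mset js"
  shows "foldr partial is p = foldr partial js p"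
  using assms
  by (auto simp: foldr_conv_fold fun_eq_iff partial_commute intro!: fun_cong[OF fold_multiset_equiv])

text \<open>The exponent inside \<open>monom_of\<close>. Its fibres are the rearrangements of a
  word, along which tensor entries are grouped.\<close>

definition expo :: "'n list \<Rightarrow> 'n \<Rightarrow>\<^sub>0 nat" where
  "expo is = (\<Sum>i\<leftarrow>is. Poly_Mapping.single i 1)"

lemma lookup_expo: "Poly_Mapping.lookup (expo is) i = count (mset is) i"
  by (induction "is") (auto simp: expo_def lookup_add lookup_single when_def)

lemma expo_eq_iff: "expo is = expo js \<longleftrightarrow> mset is = mset js"
  by (auto simp: poly_mapping_eq_iff multiset_eq_iff fun_eq_iff lookup_expo)

lemma degree_expo: "(\<Sum>i\<in>UNIV. Poly_Mapping.lookup (expo is) (i::'n::finite)) = length is"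
  by (induction "is") (auto simp: expo_def lookup_add lookup_single when_def sum.distrib)

text \<open>An unspecified factor is enough for a vanishing argument: the coefficient is 0 as soon
  as the shifted coefficient of \<open>p\<close> is.\<close>

lemma lookup_foldr_partial:
  "\<exists>c. Poly_Mapping.lookup (foldr partial is p) m = c * Poly_Mapping.lookup p (m + expo is)"
proof (induction "is" arbitrary: m)
  case Nil
  show ?case by (auto simp: expo_def intro: exI[of _ 1])
next
  case (Cons i "is")
  obtain c where "Poly_Mapping.lookup (foldr partial is p) (m + Poly_Mapping.single i 1) =
      c * Poly_Mapping.lookup p (m + Poly_Mapping.single i 1 + expo is)"
    using Cons by blast
  then show ?case
    by (auto simp: lookup_partial expo_def add_ac
        intro!: exI[of _ "of_nat (Poly_Mapping.lookup m i + 1) * c"])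
qed

text \<open>\<open>N\<close> exceeds the degree of every monomial of \<open>p\<close>, and a shift
  by \<open>expo is\<close> raises the degree by \<open>length is\<close>, beyond the support. This
  makes every Taylor expansion below a finite sum.\<close>

lemma foldr_partial_eventually_0:
  fixes p :: "'n::finite cpoly"
  shows "\<exists>N. \<forall>is. length is \<ge> N \<longrightarrow> foldr partial is p = 0"
proof -
  define deg where "deg m = (\<Sum>i\<in>UNIV. Poly_Mapping.lookup m i)" for m :: "'n \<Rightarrow>\<^sub>0 nat"
  have "finite (deg ` Poly_Mapping.keys p)" by simp
  then obtain N where N: "\<And>m. m \<in> Poly_Mapping.keys p \<Longrightarrow> deg m < N"
    unfolding finite_nat_set_iff_bounded by blast
  have "foldr partial is p = 0" if "length is \<ge> N" for "is"
  proof (rule poly_mapping_eqI)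
    fix m
    have "deg (m + expo is) \<ge> N"
      using that degree_expo[of "is"] by (simp add: deg_def lookup_add sum.distrib)
    then have "Poly_Mapping.lookup p (m + expo is) = 0"
      using N[of "m + expo is"] by (auto simp: in_keys_iff)
    then show "Poly_Mapping.lookup (foldr partial is p) m = Poly_Mapping.lookup 0 m"
      using lookup_foldr_partial[of "is" p m] by auto
  qed
  then show ?thesis by blast
qed

section \<open>Derivatives along complex lines\<close>

lemma eval_poly_partial:
  "eval_poly (partial i p) x =
     (\<Sum>m\<in>Poly_Mapping.keys p. of_nat (Poly_Mapping.lookup m i) * Poly_Mapping.lookup p m *
        ((x $ i) ^ (Poly_Mapping.lookup m i - 1) * (\<Prod>j\<in>UNIV-{i}. (x $ j) ^ Poly_Mapping.lookup m j)))"
proof -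
  have "eval_monom (m - Poly_Mapping.single i 1) x =
      (x $ i) ^ (Poly_Mapping.lookup m i - 1) * (\<Prod>j\<in>UNIV-{i}. (x $ j) ^ Poly_Mapping.lookup m j)" for m
    unfolding eval_monom_def
    by (subst prod.remove[of UNIV i]) (auto simp: lookup_minus lookup_single when_def)
  then show ?thesis
    by (simp add: partial_def eval_poly_sum eval_poly_single)
qed

lemma has_field_derivative_eval_poly_line:
  fixes p :: "'n::finite cpoly"
  shows "((\<lambda>t. eval_poly p (x + t *s h)) has_field_derivative
     (\<Sum>i\<in>UNIV. h $ i * eval_poly (partial i p) (x + t *s h))) (at t within S)"
proof -
  have "((\<lambda>t. eval_poly p (x + t *s h)) has_field_derivative
     (\<Sum>m\<in>Poly_Mapping.keys p. Poly_Mapping.lookup p m *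
       (\<Sum>i\<in>UNIV. (of_nat (Poly_Mapping.lookup m i) * h $ i *
           (x $ i + t * h $ i) ^ (Poly_Mapping.lookup m i - 1)) *
         (\<Prod>j\<in>UNIV-{i}. (x $ j + t * h $ j) ^ Poly_Mapping.lookup m j)))) (at t)"
    unfolding eval_poly_def
    by (intro DERIV_sum DERIV_cmult)
      (auto intro!: has_field_derivative_prod derivative_eq_intros)
  also have "(\<Sum>m\<in>Poly_Mapping.keys p. Poly_Mapping.lookup p m *
       (\<Sum>i\<in>UNIV. (of_nat (Poly_Mapping.lookup m i) * h $ i *
           (x $ i + t * h $ i) ^ (Poly_Mapping.lookup m i - 1)) *
         (\<Prod>j\<in>UNIV-{i}. (x $ j + t * h $ j) ^ Poly_Mapping.lookup m j))) =
      (\<Sum>i\<in>UNIV. h $ i * eval_poly (partial i p) (x + t *s h))"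
    unfolding eval_poly_partial sum_distrib_left
    by (subst sum.swap) (intro sum.cong refl, simp add: mult_ac)
  finally show ?thesis
    by (rule has_field_derivative_at_within)
qed

section \<open>Higher directional derivatives\<close>

text \<open>The entries of the pure tensor of the listed vectors, meaningful for words of the same
  length as the list.\<close>

primrec coord_prod :: "(complex^'n) list \<Rightarrow> 'n list \<Rightarrow> complex" where
  "coord_prod [] is = 1"
| "coord_prod (v # vs) is = v $ hd is * coord_prod vs (tl is)"

abbreviation words :: "nat \<Rightarrow> 'n list set" where
  "words k \<equiv> {is. length is = k}"

lemma finite_words [simp]: "finite (words k :: 'n::finite list set)"
  using finite_lists_length_eq[of "UNIV :: 'n set" k] by simp

lemma sum_words_Suc:
  "(\<Sum>is\<in>words (Suc k). g is) = (\<Sum>i\<in>(UNIV::'n::finite set). \<Sum>is\<in>words k. g (i # is))"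
proof -
  have "words (Suc k) = (\<lambda>(i::'n, is). i # is) ` (UNIV \<times> words k)"
    by (auto simp: length_Suc_conv image_iff)
  moreover have "inj_on (\<lambda>(i::'n, is). i # is) (UNIV \<times> words k)"
    by (auto simp: inj_on_def)
  ultimately show ?thesis
    by (simp add: sum.reindex sum.cartesian_product case_prod_unfold)
qed

text \<open>The multilinear form \<open>D^k p(x)(v_1, ..., v_k)\<close>: the tensor of partial
  derivatives contracted with a pure tensor. Differentiating once more along \<open>h\<close> puts
  \<open>h\<close> in front of the list.\<close>

definition dir_deriv :: "(complex^'n) list \<Rightarrow> 'n::finite cpoly \<Rightarrow> complex^'n \<Rightarrow> complex" where
  "dir_deriv vs p x =
     (\<Sum>is\<in>words (length vs). coord_prod vs is * eval_poly (foldr partial is p) x)"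

lemma dir_deriv_Nil [simp]: "dir_deriv [] p x = eval_poly p x"
  by (simp add: dir_deriv_def)

lemma dir_deriv_Cons:
  "dir_deriv (v # vs) p x = (\<Sum>is\<in>words (length vs). coord_prod vs is *
     (\<Sum>i\<in>UNIV. v $ i * eval_poly (partial i (foldr partial is p)) x))"
  unfolding dir_deriv_def length_Cons sum_words_Suc sum_distrib_left
  by (subst sum.swap) (intro sum.cong refl, simp add: mult_ac)

lemma dir_deriv_single: "dir_deriv [v] p x = (\<Sum>i\<in>UNIV. v $ i * eval_poly (partial i p) x)"
  by (simp add: dir_deriv_Cons)

lemma has_field_derivative_dir_deriv_line:
  "((\<lambda>t. dir_deriv vs p (x + t *s h)) has_field_derivative dir_deriv (h # vs) p (x + t *s h))
     (at t within S)"
  unfolding dir_deriv_def[of vs] dir_deriv_Cons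
  by (intro DERIV_sum DERIV_cmult has_field_derivative_eval_poly_line)

text \<open>One-variable complex Taylor expansion of \<open>t\<close> \<mapsto>
  \<open>x + t *s h\<close> from 0 to 1. The remainder involves words of length above
  \<open>n\<close>, so its bound is 0 and the expansion is exact.\<close>

lemma dir_deriv_Taylor:
  assumes "\<And>is. length is > n \<Longrightarrow> foldr partial is p = 0"
  shows "dir_deriv vs p (x + h) = (\<Sum>k\<le>n. dir_deriv (replicate k h @ vs) p x / fact k)"
proof -
  have "cmod (dir_deriv (replicate 0 h @ vs) p (x + 1 *s h) -
      (\<Sum>k\<le>n. dir_deriv (replicate k h @ vs) p (x + 0 *s h) * (1 - 0) ^ k / fact k))
      \<le> 0 * cmod (1 - 0) ^ Suc n / fact n"
  proof (rule complex_Taylor[where S = UNIV and f = "\<lambda>k t. dir_deriv (replicate k h @ vs) p (x + t *s h)"])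
    show "((\<lambda>t. dir_deriv (replicate k h @ vs) p (x + t *s h)) has_field_derivative
        dir_deriv (replicate (Suc k) h @ vs) p (x + t *s h)) (at t within UNIV)" for k t
      using has_field_derivative_dir_deriv_line[of "replicate k h @ vs" p x h t UNIV] by simp
    have "foldr partial is p = 0" if "is \<in> words (length (replicate (Suc n) h @ vs))" for "is"
      by (rule assms) (use that in auto)
    then show "cmod (dir_deriv (replicate (Suc n) h @ vs) p (x + t *s h)) \<le> 0" for t
      by (simp add: dir_deriv_def)
  qed auto
  then show ?thesis by simp
qed

section \<open>The norm on symmetric powers\<close>

lemma norm_vec_sq: "(norm (v :: complex^'n::finite))\<^sup>2 = (\<Sum>i\<in>UNIV. (cmod (v $ i))\<^sup>2)"
  by (simp add: norm_vec_def L2_set_def sum_nonneg)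

lemma norm_vector_smult: "norm (c *s (v :: complex^'n::finite)) = cmod c * norm v"
proof (rule power2_eq_imp_eq)
  show "(norm (c *s v))\<^sup>2 = (cmod c * norm v)\<^sup>2"
    by (simp add: norm_vec_sq power_mult_distrib norm_mult sum_distrib_left)
qed auto

lemma matrix_vector_mult_sum_right: "A *v (\<Sum>i\<in>I. g i) = (\<Sum>i\<in>I. A *v g i)"
  for A :: "complex^'n::finite^'m"
  by (induction I rule: infinite_finite_induct) (auto simp: matrix_vector_right_distrib)

section \<open>Multinomial coefficients as numbers of words\<close>

lemma multinomial_expo:
  fixes "is" :: "'n::finite list"
  assumes "length is = k"
  shows "real (card {js \<in> words k. expo js = expo is}) = multinomial k (expo is)"
proof -
  let ?A = "mset is"
  have "{js \<in> words k. expo js = expo is} = permutations_of_multiset ?A"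
    using assms by (auto simp: permutations_of_multiset_def expo_eq_iff dest: mset_eq_length)
  \<comment> \<open>The permutation count runs over the letters that occur,
    \<open>multinomial\<close> over all variables; the extra factors are 0! = 1.\<close>
  moreover have "(\<Prod>i\<in>set_mset ?A. fact (count ?A i)) = (\<Prod>i\<in>UNIV. (fact (count ?A i) :: nat))"
  proof (rule prod.mono_neutral_left)
    show "\<forall>i\<in>UNIV - set_mset ?A. fact (count ?A i) = (1 :: nat)"
    proof
      fix i
      assume "i \<in> UNIV - set_mset ?A"
      then have "count ?A i = 0"
        by (simp add: count_eq_zero_iff)
      then show "fact (count ?A i) = (1 :: nat)"
        by (simp only: fact_0)
    qed
  qed auto
  ultimately have "card {js \<in> words k. expo js = expo is} * (\<Prod>i\<in>UNIV. fact (count ?A i)) = fact k"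
    using card_permutations_of_multiset_aux[of ?A] assms by simp
  from arg_cong[OF this, of real]
  have "real (card {js \<in> words k. expo js = expo is}) * (\<Prod>i\<in>UNIV. fact (count ?A i)) = fact k"
    by (simp only: of_nat_mult of_nat_prod of_nat_fact)
  then show ?thesis
    by (simp add: multinomial_def lookup_expo field_simps)
qed

lemma multinomial_expo_ge_1:
  assumes "length is = k"
  shows "multinomial k (expo (is :: 'n::finite list)) \<ge> 1"
proof -
  have "card {js \<in> words k. expo js = expo is} \<noteq> 0"
    using assms by (subst card_0_eq) auto
  then have "real (card {js \<in> words k. expo js = expo is}) \<ge> 1"
    by linarith
  then show ?thesis
    by (simp only: multinomial_expo[OF assms])
qed

lemma expo_surj: "\<exists>is. expo is = (m :: 'n::finite \<Rightarrow>\<^sub>0 nat)"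
proof -
  obtain "is" where "mset is = Abs_multiset (Poly_Mapping.lookup m)"
    using ex_mset by blast
  then have "expo is = m"
    by (intro poly_mapping_eqI) (simp add: lookup_expo)
  then show ?thesis by blast
qed

lemma hom_exponents_eq: "{m. (\<Sum>i\<in>(UNIV::'n::finite set). Poly_Mapping.lookup m i) = k} = expo ` words k"
proof -
  have "m \<in> expo ` words k" if m: "(\<Sum>i\<in>(UNIV::'n set). Poly_Mapping.lookup m i) = k" for m
  proof -
    obtain "is" where "expo is = m"
      using expo_surj by blast
    moreover from this m have "length is = k"
      using degree_expo[of "is"] by simp
    ultimately show ?thesis by blast
  qed
  then show ?thesis
    using degree_expo by auto
qed

text \<open>The Frobenius norm is multiplicative on pure tensors: the sum over words splits at the
  first letter.\<close>

lemma sum_coord_prod_sq: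
  fixes vs :: "(complex^'n::finite) list"
  shows "(\<Sum>is\<in>words (length vs). (cmod (coord_prod vs is))\<^sup>2) = (\<Prod>v\<leftarrow>vs. norm v)\<^sup>2"
proof (induction vs)
  case (Cons v vs)
  have "(\<Sum>is\<in>words (length (v # vs)). (cmod (coord_prod (v # vs) is))\<^sup>2) =
      (\<Sum>i\<in>UNIV. (cmod (v $ i))\<^sup>2) * (\<Sum>is\<in>words (length vs). (cmod (coord_prod vs is))\<^sup>2)"
    unfolding length_Cons sum_words_Suc sum_product by (simp add: norm_mult power_mult_distrib)
  then show ?case
    using Cons by (simp add: norm_vec_sq power_mult_distrib)
qed auto

text \<open>A homogeneous polynomial is viewed as a symmetric tensor, whose Frobenius norm is the
  unitarily invariant norm of the polynomial.\<close>

definition tensor_coeff :: "nat \<Rightarrow> 'n::finite cpoly \<Rightarrow> 'n list \<Rightarrow> complex" where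
  "tensor_coeff k p is =
     Poly_Mapping.lookup p (expo is) / of_real (multinomial k (expo is))"

text \<open>Each of the \<open>multinomial k \<nu>\<close> words over \<nu> contributes the squared
  coefficient divided by the square of that number, so a fibre sums to one term of
  \<open>hom_norm\<close>. Monomials of a degree other than \<open>k\<close> contribute to the right
  side only, hence an inequality.\<close>

lemma sum_tensor_coeff_sq_le:
  fixes p :: "'n::finite cpoly"
  shows "(\<Sum>is\<in>words k. (cmod (tensor_coeff k p is))\<^sup>2) \<le> (hom_norm k p)\<^sup>2"
proof -
  define g where "g \<nu> = (cmod (Poly_Mapping.lookup p \<nu>))\<^sup>2 / multinomial k \<nu>" for \<nu>
  have mult_nonneg: "multinomial k \<nu> \<ge> 0" for \<nu> :: "'n \<Rightarrow>\<^sub>0 nat"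
    by (simp add: multinomial_def prod_nonneg)
  have g_nonneg: "g \<nu> \<ge> 0" for \<nu>
    by (simp add: g_def mult_nonneg)
  have fibre: "(\<Sum>is | is \<in> words k \<and> expo is = \<nu>. (cmod (tensor_coeff k p is))\<^sup>2) = g \<nu>"
    if \<nu>: "\<nu> \<in> expo ` words k" for \<nu>
  proof -
    obtain js where js: "length js = k" "\<nu> = expo js"
      using \<nu> by auto
    have "(\<Sum>is | is \<in> words k \<and> expo is = \<nu>. (cmod (tensor_coeff k p is))\<^sup>2) =
        (\<Sum>is | is \<in> words k \<and> expo is = \<nu>. (cmod (Poly_Mapping.lookup p \<nu>))\<^sup>2 / (multinomial k \<nu>)\<^sup>2)"
      by (rule sum.cong) (auto simp: tensor_coeff_def norm_divide power_divide)
    also have "\<dots> = multinomial k \<nu> * ((cmod (Poly_Mapping.lookup p \<nu>))\<^sup>2 / (multinomial k \<nu>)\<^sup>2)"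
      using multinomial_expo[OF js(1)] js(2) by simp
    also have "\<dots> = g \<nu>"
      by (simp add: g_def power2_eq_square)
    finally show ?thesis .
  qed
  have "(\<Sum>is\<in>words k. (cmod (tensor_coeff k p is))\<^sup>2) = (\<Sum>\<nu>\<in>expo ` words k. g \<nu>)"
    by (subst sum.image_gen[where g = expo]) (auto intro!: sum.cong fibre[simplified])
  also have "\<dots> = (\<Sum>\<nu>\<in>expo ` words k \<inter> Poly_Mapping.keys p. g \<nu>)"
    by (rule sum.mono_neutral_right) (auto simp: g_def in_keys_iff)
  also have "\<dots> \<le> (\<Sum>\<nu>\<in>Poly_Mapping.keys p. g \<nu>)"
    by (rule sum_mono2) (auto simp: g_nonneg)
  also have "\<dots> = (hom_norm k p)\<^sup>2"
    using g_nonneg by (simp add: hom_norm_def g_def sum_nonneg)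
  finally show ?thesis .
qed

lemma hom_norm_nonneg: "hom_norm k p \<ge> 0"
  by (simp add: hom_norm_def multinomial_def sum_nonneg prod_nonneg)

text \<open>The symmetric product of the vectors as a functional: \<open>p\<close> is sent to its
  polarization. With all vectors equal to \<open>v\<close> and \<open>p\<close> homogeneous of the
  matching degree, this is evaluation at \<open>v\<close>.\<close>

definition sym_product :: "(complex^'n) list \<Rightarrow> 'n::finite cpoly \<Rightarrow> complex" where
  "sym_product vs p =
     (\<Sum>is\<in>words (length vs). tensor_coeff (length vs) p is * coord_prod vs is)"

lemma sym_product_add: "sym_product vs (p + q) = sym_product vs p + sym_product vs q"
  by (simp add: sym_product_def tensor_coeff_def lookup_add add_divide_distrib distrib_right
      sum.distrib)

lemma sym_product_scale: "sym_product vs (Poly_Mapping.map (\<lambda>a. c * a) p) = c * sym_product vs p"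
proof -
  have "Poly_Mapping.lookup (Poly_Mapping.map (\<lambda>a. c * a) p) m = c * Poly_Mapping.lookup p m" for m
    by (simp add: Poly_Mapping.map.rep_eq when_def)
  then show ?thesis
    by (simp add: sym_product_def tensor_coeff_def sum_distrib_left mult.assoc)
qed

text \<open>Cauchy-Schwarz is applied over words rather than exponent vectors, because there the
  norm of the pure tensor factors exactly.\<close>

lemma cmod_sym_product_le: "cmod (sym_product vs p) \<le> hom_norm (length vs) p * (\<Prod>v\<leftarrow>vs. norm v)"
proof -
  let ?W = "words (length vs) :: 'a list set"
  let ?a = "\<lambda>is. cmod (tensor_coeff (length vs) p is)"
  let ?b = "\<lambda>is. cmod (coord_prod vs is)"
  have "0 \<le> (\<Prod>v\<leftarrow>vs. norm v)"
    by (induction vs) auto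
  then have b: "L2_set ?b ?W = (\<Prod>v\<leftarrow>vs. norm v)"
    by (simp add: L2_set_def sum_coord_prod_sq)
  have a: "L2_set ?a ?W \<le> hom_norm (length vs) p"
    unfolding L2_set_def
    by (rule real_le_lsqrt) (auto simp: sum_tensor_coeff_sq_le hom_norm_nonneg sum_nonneg)
  have "cmod (sym_product vs p) \<le> (\<Sum>is\<in>?W. \<bar>?a is\<bar> * \<bar>?b is\<bar>)"
    unfolding sym_product_def by (rule sum_norm_le) (simp add: norm_mult)
  also have "\<dots> \<le> L2_set ?a ?W * L2_set ?b ?W"
    by (rule L2_set_mult_ineq)
  also have "\<dots> \<le> hom_norm (length vs) p * (\<Prod>v\<leftarrow>vs. norm v)"
    unfolding b by (rule mult_right_mono) (use a \<open>0 \<le> (\<Prod>v\<leftarrow>vs. norm v)\<close> in auto)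
  finally show ?thesis .
qed

lemma monom_of_eq: "monom_of is = Poly_Mapping.single (expo is) 1"
  by (simp add: monom_of_def expo_def)

lemma sym_product_monom:
  assumes "length is = length vs"
  shows "sym_product vs (monom_of is) =
    (\<Sum>js | js \<in> words (length vs) \<and> expo js = expo is.
       coord_prod vs js / of_real (multinomial (length vs) (expo is)))"
  unfolding sym_product_def
  by (rule sum.mono_neutral_cong_right)
    (auto simp: tensor_coeff_def monom_of_eq lookup_single when_def)

definition dir_deriv_sys :: "(complex^'n) list \<Rightarrow> 'n::finite polysys \<Rightarrow> complex^'n \<Rightarrow> complex^'n" where
  "dir_deriv_sys vs f x = (\<chi> i. dir_deriv vs (f $ i) x)"

text \<open>Partial derivatives commute, so the derivative tensor is symmetric and cannot
  distinguish a pure tensor from its symmetrization.\<close>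

lemma deriv_tensor_sym_product:
  fixes f :: "'n::finite polysys"
  assumes "length vs = k"
  shows "deriv_tensor f k x (sym_product vs) = dir_deriv_sys vs f x"
proof -
  have "(\<Sum>is\<in>words k. eval_poly (foldr partial is p) x * sym_product vs (monom_of is)) =
      dir_deriv vs p x" for p
  proof -
    let ?D = "\<lambda>is. eval_poly (foldr partial is p) x"
    let ?m = "\<lambda>is. complex_of_real (multinomial k (expo is))"
    have "(\<Sum>is\<in>words k. ?D is * sym_product vs (monom_of is)) =
        (\<Sum>is\<in>words k. \<Sum>js | js \<in> words k \<and> expo js = expo is. ?D is * coord_prod vs js / ?m is)"
      by (rule sum.cong) (use assms in \<open>auto simp: sym_product_monom sum_distrib_left\<close>)
    also have "\<dots> = (\<Sum>js\<in>words k. \<Sum>is | is \<in> words k \<and> expo js = expo is.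
        ?D is * coord_prod vs js / ?m is)"
      by (rule sum.swap_restrict) auto
    also have "\<dots> = (\<Sum>js\<in>words k. coord_prod vs js * ?D js)"
    proof (rule sum.cong[OF refl])
      fix js :: "'n list"
      assume "js \<in> words k"
      then have js: "length js = k" by simp
      have D: "?D is = ?D js" if "expo is = expo js" for "is"
        using foldr_partial_permute[of "is" js p] that by (simp add: expo_eq_iff)
      have "(\<Sum>is | is \<in> words k \<and> expo js = expo is. ?D is * coord_prod vs js / ?m is) =
          (\<Sum>is | is \<in> words k \<and> expo is = expo js. ?D js * coord_prod vs js / ?m js)"
      proof (rule sum.cong)
        fix "is"
        assume "is \<in> {is. is \<in> words k \<and> expo is = expo js}"
        then have "expo is = expo js" by simp
        then show "?D is * coord_prod vs js / ?m is = ?D js * coord_prod vs js / ?m js"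
          by (simp only: D[of "is"])
      qed auto
      \<comment> \<open>All summands over the fibre are equal, and their number cancels the
        denominator.\<close>
      also have "\<dots> = ?m js * (?D js * coord_prod vs js / ?m js)"
        using multinomial_expo[OF js, symmetric] by simp
      also have "\<dots> = coord_prod vs js * ?D js"
        using multinomial_expo_ge_1[OF js] by simp
      finally show "(\<Sum>is | is \<in> words k \<and> expo js = expo is. ?D is * coord_prod vs js / ?m is) =
        coord_prod vs js * ?D js" .
    qed
    finally show ?thesis
      by (simp add: dir_deriv_def assms)
  qed
  then show ?thesis
    by (simp add: deriv_tensor_def dir_deriv_sys_def)
qed

section \<open>Boundedness of the sets behind the dual and operator norms\<close>

lemma sym_power_expand:
  fixes p :: "'n::finite cpoly"
  assumes L: "L \<in> sym_power k" and p: "p \<in> hom_polys k"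
  shows "L p = (\<Sum>m\<in>Poly_Mapping.keys p. Poly_Mapping.lookup p m * L (Poly_Mapping.single m 1))"
proof -
  let ?s = "\<lambda>m. Poly_Mapping.single m (Poly_Mapping.lookup p m)"
  have add: "L (p + q) = L p + L q" if "p \<in> hom_polys k" "q \<in> hom_polys k" for p q
    using L that unfolding sym_power_def by blast
  have scale: "L (Poly_Mapping.map (\<lambda>a. c * a) p) = c * L p" if "p \<in> hom_polys k" for c p
    using L that unfolding sym_power_def by blast
  have hom_0: "0 \<in> hom_polys k"
    by (simp add: hom_polys_def)
  have hom_add: "p + q \<in> hom_polys k" if "p \<in> hom_polys k" "q \<in> hom_polys k" for p q :: "'n cpoly"
    using that Poly_Mapping.keys_add[of p q] unfolding hom_polys_def by blast
  have L0: "L 0 = 0"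
  proof -
    have "Poly_Mapping.map (\<lambda>a. 0 * a) (0 :: 'n cpoly) = 0"
      by (rule poly_mapping_eqI) (simp add: Poly_Mapping.map.rep_eq)
    then show ?thesis
      using scale[OF hom_0, of 0] by simp
  qed
  have hom_s: "?s m \<in> hom_polys k" and hom_1: "Poly_Mapping.single m 1 \<in> hom_polys k"
    if "m \<in> Poly_Mapping.keys p" for m
    using p that by (auto simp: hom_polys_def)
  have Ls: "L (?s m) = Poly_Mapping.lookup p m * L (Poly_Mapping.single m 1)"
    if "m \<in> Poly_Mapping.keys p" for m
  proof -
    have "Poly_Mapping.map (\<lambda>a. Poly_Mapping.lookup p m * a) (Poly_Mapping.single m 1) = ?s m"
      by (rule poly_mapping_eqI)
        (auto simp: Poly_Mapping.map.rep_eq lookup_single when_def)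
    then show ?thesis
      using scale[OF hom_1[OF that]] by metis
  qed
  \<comment> \<open>\<open>L\<close> is linear on \<open>hom_polys k\<close> only, so the induction
    must carry membership of the partial sums.\<close>
  have expand: "(\<Sum>m\<in>A. ?s m) \<in> hom_polys k \<and>
      L (\<Sum>m\<in>A. ?s m) = (\<Sum>m\<in>A. Poly_Mapping.lookup p m * L (Poly_Mapping.single m 1))"
    if "finite A" "A \<subseteq> Poly_Mapping.keys p" for A
    using that by (induction A) (auto simp: L0 hom_0 hom_add hom_s add Ls)
  have "(\<Sum>m\<in>Poly_Mapping.keys p. ?s m) = p"
  proof (rule poly_mapping_eqI)
    fix m'
    show "Poly_Mapping.lookup (\<Sum>m\<in>Poly_Mapping.keys p. ?s m) m' = Poly_Mapping.lookup p m'"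
      unfolding lookup_sum lookup_single when_def sum.delta[OF finite_keys]
      by (simp add: in_keys_iff)
  qed
  then show ?thesis
    using expand[OF finite_keys order_refl] by simp
qed

text \<open>A real \<open>SUP\<close> dominates its members only over a bounded set. The bound is
  explicit: in the unit ball a coefficient is at most the square root of its multinomial, and only
  finitely many monomials have degree \<open>k\<close>.\<close>

lemma cmod_le_sym_norm:
  fixes L :: "'n::finite cpoly \<Rightarrow> complex"
  assumes L: "L \<in> sym_power k" and p: "p \<in> hom_polys k" "hom_norm k p \<le> 1"
  shows "cmod (L p) \<le> sym_norm k L"
proof -
  let ?D = "expo ` (words k :: 'n list set)"
  have "cmod (L q) \<le> (\<Sum>m\<in>?D. sqrt (multinomial k m) * cmod (L (Poly_Mapping.single m 1)))"
    if q: "q \<in> hom_polys k" "hom_norm k q \<le> 1" for q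
  proof -
    have keys: "Poly_Mapping.keys q \<subseteq> ?D"
      using q(1) unfolding hom_exponents_eq[symmetric] by (auto simp: hom_polys_def)
    have pos: "multinomial k m > 0" if m: "m \<in> ?D" for m
    proof -
      obtain "is" :: "'n list" where "length is = k" "m = expo is"
        using m by blast
      then show ?thesis
        using multinomial_expo_ge_1[of "is" k] by simp
    qed
    have coeff: "cmod (Poly_Mapping.lookup q m) \<le> sqrt (multinomial k m)"
      if m: "m \<in> Poly_Mapping.keys q" for m
    proof -
      have "(cmod (Poly_Mapping.lookup q m))\<^sup>2 / multinomial k m \<le>
          (\<Sum>m\<in>Poly_Mapping.keys q. (cmod (Poly_Mapping.lookup q m))\<^sup>2 / multinomial k m)"
      proof (rule member_le_sum)
        fix m'
        assume "m' \<in> Poly_Mapping.keys q - {m}"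
        then have "multinomial k m' > 0"
          using keys pos by blast
        then show "0 \<le> (cmod (Poly_Mapping.lookup q m'))\<^sup>2 / multinomial k m'"
          by simp
      qed (use m in auto)
      also have "\<dots> \<le> 1"
        using q(2) by (simp add: hom_norm_def)
      finally have "(cmod (Poly_Mapping.lookup q m))\<^sup>2 \<le> multinomial k m"
        using pos[of m] m keys by (auto simp: divide_le_eq)
      then show ?thesis
        by (rule real_le_rsqrt)
    qed
    have "cmod (L q) \<le> (\<Sum>m\<in>Poly_Mapping.keys q.
        sqrt (multinomial k m) * cmod (L (Poly_Mapping.single m 1)))"
      unfolding sym_power_expand[OF L q(1)]
      by (rule sum_norm_le) (auto simp: norm_mult intro!: mult_right_mono coeff)
    also have "\<dots> \<le> (\<Sum>m\<in>?D. sqrt (multinomial k m) * cmod (L (Poly_Mapping.single m 1)))"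
      by (rule sum_mono2) (use keys pos in \<open>auto intro!: mult_nonneg_nonneg simp: less_imp_le\<close>)
    finally show ?thesis .
  qed
  then have "bdd_above ((\<lambda>p. cmod (L p)) ` {p \<in> hom_polys k. hom_norm k p \<le> 1})"
    by (intro bdd_aboveI2) auto
  then show ?thesis
    unfolding sym_norm_def by (rule cSUP_upper[rotated]) (use p in auto)
qed

text \<open>The norm of a monomial is one over the square root of its multinomial coefficient, so
  monomials lie in the unit ball.\<close>

lemma cmod_monom_le_1:
  fixes L :: "'n::finite cpoly \<Rightarrow> complex"
  assumes "L \<in> sym_power k" "sym_norm k L \<le> 1" "length is = k"
  shows "cmod (L (monom_of is)) \<le> 1"
proof -
  have "monom_of is \<in> hom_polys k"
    using assms(3) degree_expo[of "is"] by (simp add: hom_polys_def monom_of_eq)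
  moreover have "hom_norm k (monom_of is) \<le> 1"
    using multinomial_expo_ge_1[OF assms(3)] by (simp add: hom_norm_def monom_of_eq)
  ultimately show ?thesis
    using cmod_le_sym_norm[OF assms(1)] assms(2) by force
qed

lemma deriv_tensor_eq_sum:
  "deriv_tensor f k x L = (\<Sum>is\<in>words k. L (monom_of is) *s (\<chi> j. eval_poly (foldr partial is (f $ j)) x))"
  by (simp add: vec_eq_iff deriv_tensor_def mult.commute)

text \<open>Boundedness again: the image of \<open>L\<close> is a combination of fixed vectors, one
  per word, with coefficients of modulus at most 1.\<close>

lemma norm_le_sym_onorm:
  fixes f :: "'n::finite polysys" and c :: complex and A :: "complex^'n^'n" and x :: "complex^'n"
  defines "T \<equiv> \<lambda>k L. c *s (A *v deriv_tensor f k x L)"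
  assumes L: "L \<in> sym_power k" "sym_norm k L \<le> 1"
  shows "norm (T k L) \<le> sym_onorm k (T k)"
proof -
  define e where "e is = c *s (A *v (\<chi> j. eval_poly (foldr partial is (f $ j)) x))" for "is"
  have T: "T k L = (\<Sum>is\<in>words k. L (monom_of is) *s e is)" for L
    unfolding T_def e_def deriv_tensor_eq_sum
    by (simp add: matrix_vector_mult_sum_right vector_scalar_commute vec.scale_sum_right mult.commute)
  have "norm (T k L) \<le> (\<Sum>is\<in>words k. norm (e is))"
    if "L \<in> sym_power k" "sym_norm k L \<le> 1" for L
    unfolding T
    by (rule sum_norm_le) (auto simp: norm_vector_smult cmod_monom_le_1[OF that] intro!: mult_left_le_one_le)
  then have "bdd_above ((\<lambda>L. norm (T k L)) ` {L \<in> sym_power k. sym_norm k L \<le> 1})"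
    by (intro bdd_aboveI2) auto
  then show ?thesis
    unfolding sym_onorm_def by (rule cSUP_upper[rotated]) (use L in auto)
qed

text \<open>Divided by the product of the norms, \<open>sym_product vs\<close> enters the dual unit
  ball and competes in the supremum defining \<open>sym_onorm\<close>.\<close>

lemma norm_dir_deriv_sys_le:
  fixes f :: "'n::finite polysys" and c :: complex and A :: "complex^'n^'n"
  assumes len: "length vs = k"
  shows "norm (c *s (A *v dir_deriv_sys vs f x)) \<le>
     sym_onorm k (\<lambda>L. c *s (A *v deriv_tensor f k x L)) * (\<Prod>v\<leftarrow>vs. norm v)"
proof (cases "(\<Prod>v\<leftarrow>vs. norm v) = 0")
  \<comment> \<open>Normalization is impossible here, but the Cauchy-Schwarz bound makes the
    functional itself vanish.\<close>
  case True
  then have "sym_product vs p = 0" for p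
    using cmod_sym_product_le[of vs p] by simp
  then have "dir_deriv_sys vs f x = 0"
    using deriv_tensor_sym_product[OF len, of f x] by (simp add: vec_eq_iff deriv_tensor_def)
  then show ?thesis using True by simp
next
  case False
  define r where "r = (\<Prod>v\<leftarrow>vs. norm v)"
  have "r \<ge> 0" unfolding r_def by (induction vs) auto
  with False have r: "r > 0" by (simp add: r_def)
  let ?L = "\<lambda>p. sym_product vs p / of_real r"
  have "?L \<in> sym_power k"
    by (auto simp: sym_power_def sym_product_add sym_product_scale add_divide_distrib)
  moreover have "sym_norm k ?L \<le> 1"
    unfolding sym_norm_def
  proof (rule cSUP_least)
    have "0 \<in> {p \<in> hom_polys k. hom_norm k p \<le> 1}"
      by (simp add: hom_polys_def hom_norm_def)
    then show "{p \<in> hom_polys k. hom_norm k p \<le> 1} \<noteq> {}" by blast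
  next
    fix p :: "'n cpoly"
    assume "p \<in> {p \<in> hom_polys k. hom_norm k p \<le> 1}"
    then have "hom_norm k p * r \<le> 1 * r"
      using r by (intro mult_right_mono) auto
    with cmod_sym_product_le[of vs p] have "cmod (sym_product vs p) \<le> r"
      by (simp add: len flip: r_def)
    then show "cmod (?L p) \<le> 1"
      using r by (simp add: norm_divide)
  qed
  ultimately have "norm (c *s (A *v deriv_tensor f k x ?L)) \<le>
      sym_onorm k (\<lambda>L. c *s (A *v deriv_tensor f k x L))"
    by (rule norm_le_sym_onorm)
  moreover have "deriv_tensor f k x ?L = (1 / of_real r) *s dir_deriv_sys vs f x"
    unfolding deriv_tensor_sym_product[OF len, symmetric]
    by (simp add: vec_eq_iff deriv_tensor_def sum_divide_distrib)
  ultimately show ?thesis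
    using r by (simp add: vector_scalar_commute norm_vector_smult norm_divide field_simps flip: r_def)
qed

section \<open>Second-order estimates\<close>

lemma dir_deriv_sys_Nil: "dir_deriv_sys [] f x = eval_sys f x"
  by (simp add: dir_deriv_sys_def eval_sys_def)

lemma dir_deriv_sys_single: "dir_deriv_sys [w] f x = jacobian f x *v w"
  by (simp add: dir_deriv_sys_def dir_deriv_single jacobian_def matrix_vector_mult_def mult.commute)

lemma dir_deriv_sys_Taylor:
  fixes f :: "'n::finite polysys"
  shows "\<exists>n. dir_deriv_sys vs f (x + h) =
     (\<Sum>k\<le>n. (1 / fact k) *s dir_deriv_sys (replicate k h @ vs) f x)"
proof -
  have "\<forall>i. \<exists>N. \<forall>is. length is \<ge> N \<longrightarrow> foldr partial is (f $ i) = 0"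
    using foldr_partial_eventually_0 by blast
  then obtain N where N: "\<And>i is. length is \<ge> N i \<Longrightarrow> foldr partial is (f $ i) = 0"
    by metis
  define n where "n = (\<Sum>i\<in>UNIV. N i)"
  have "foldr partial is (f $ i) = 0" if "length is > n" for "is" i
  proof (rule N)
    have "N i \<le> n" unfolding n_def by (rule member_le_sum) auto
    then show "N i \<le> length is" using that by simp
  qed
  then have "dir_deriv_sys vs f (x + h) =
      (\<Sum>k\<le>n. (1 / fact k) *s dir_deriv_sys (replicate k h @ vs) f x)"
    by (simp add: vec_eq_iff dir_deriv_sys_def dir_deriv_Taylor)
  then show ?thesis by blast
qed

section \<open>Calculus along real segments\<close>

lemma norm_axis: "norm (axis i (c :: complex) :: complex^'n::finite) = cmod c"
proof -
  have "(norm (axis i c :: complex^'n))\<^sup>2 = (cmod c)\<^sup>2"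
    unfolding norm_vec_sq axis_def by (simp add: if_distrib[of cmod] if_distrib[of "\<lambda>x. x\<^sup>2"] cong: if_cong)
  then show ?thesis by simp
qed

lemma has_vector_derivative_vec_lambda:
  fixes g :: "'n::finite \<Rightarrow> real \<Rightarrow> complex"
  assumes "\<And>i. (g i has_vector_derivative g' i) (at t within S)"
  shows "((\<lambda>t. \<chi> i. g i t) has_vector_derivative (\<chi> i. g' i)) (at t within S)"
proof -
  have expand: "(\<chi> i. v i) = (\<Sum>i\<in>UNIV. axis i (v i))" for v :: "'n \<Rightarrow> complex"
    by (simp add: vec_eq_iff axis_def)
  have "bounded_linear (axis i :: complex \<Rightarrow> complex^'n)" for i
    by (rule bounded_linear_intro[where K = 1]) (simp_all add: norm_axis, auto simp: vec_eq_iff axis_def)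
  from bounded_linear.has_vector_derivative[OF this assms]
  show ?thesis
    unfolding expand by (intro has_vector_derivative_sum)
qed

lemma scaleR_eq_smult: "t *\<^sub>R (v :: complex^'n) = of_real t *s v"
  by (simp add: vec_eq_iff scaleR_conv_of_real[where 'a = complex])

text \<open>The complex parameter is restricted to real values because the mean value inequality
  concerns curves over a real interval.\<close>

lemma has_vector_derivative_dir_deriv_sys_line:
  "((\<lambda>t. A *v dir_deriv_sys vs f (z + t *\<^sub>R d)) has_vector_derivative
     A *v dir_deriv_sys (d # vs) f (z + t *\<^sub>R d)) (at t within S)"
proof -
  have "((\<lambda>t. dir_deriv vs p (z + t *\<^sub>R d)) has_vector_derivative
      dir_deriv (d # vs) p (z + t *\<^sub>R d)) (at t within S)" for p
  proof -
    have "(((\<lambda>t. dir_deriv vs p (z + t *s d)) \<circ> of_real) has_vector_derivative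
        1 * dir_deriv (d # vs) p (z + of_real t *s d)) (at t within S)"
      by (rule field_vector_diff_chain_within)
        (auto intro!: derivative_eq_intros has_field_derivative_dir_deriv_line)
    then show ?thesis by (simp add: o_def scaleR_eq_smult)
  qed
  then show ?thesis
    unfolding dir_deriv_sys_def
    by (intro bounded_linear.has_vector_derivative[OF matrix_vector_mul_bounded_linear]
        has_vector_derivative_vec_lambda)
qed

text \<open>Mean value inequality against \<open>C * t ^ Suc n\<close>: \<open>n = 0\<close> gives
  Lipschitz bounds, \<open>n = 1\<close> the factor 1/2 of a second-order remainder.\<close>

lemma norm_increment_le:
  fixes \<phi> :: "real \<Rightarrow> 'a::real_normed_vector"
  assumes "0 \<le> b" and \<phi>: "\<And>t. (\<phi> has_vector_derivative \<phi>' t) (at t)"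
    and bound: "\<And>t. 0 \<le> t \<Longrightarrow> t \<le> b \<Longrightarrow> norm (\<phi>' t) \<le> C * real (Suc n) * t ^ n"
  shows "norm (\<phi> b - \<phi> 0) \<le> C * b ^ Suc n"
proof (cases "b = 0")
  case False
  have "norm (\<phi> b - \<phi> 0) \<le> C * b ^ Suc n - C * 0 ^ Suc n"
  proof (rule differentiable_bound_general[where \<phi> = "\<lambda>t. C * t ^ Suc n"
        and \<phi>' = "\<lambda>t. C * real (Suc n) * t ^ n" and f' = \<phi>'])
    show "continuous_on {0..b} \<phi>"
      using \<phi> by (meson continuous_at_imp_continuous_on has_vector_derivative_continuous)
    have "((\<lambda>t. C * t ^ Suc n) has_real_derivative C * real (Suc n) * t ^ n) (at t)" for t
      using DERIV_cmult[OF DERIV_pow[of "Suc n" t], of C] by (simp add: mult.assoc)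
    then show "((\<lambda>t. C * t ^ Suc n) has_vector_derivative C * real (Suc n) * t ^ n) (at t)" for t
      by (simp add: has_real_derivative_iff_has_vector_derivative)
  qed (use assms False in \<open>auto intro!: continuous_intros\<close>)
  then show ?thesis by simp
qed (use assms in auto)

text \<open>The full series is the second derivative of the geometric series,
  \<open>2 / (1 - u) ^ 3\<close>. Truncation leaves the remainder \<open>u ^ n * q n\<close>, which
  is nonnegative.\<close>

lemma sum_binomial_series_le:
  fixes u :: real
  assumes "0 \<le> u" "u \<le> 1"
  shows "(1 - u) ^ 3 * (\<Sum>k<n. real ((k + 1) * (k + 2)) * u ^ k) \<le> 2"
proof -
  define q where "q n = real (n + 1) * real (n + 2) - 2 * real n * real (n + 2) * u + real n * real (n + 1) * u\<^sup>2"
    for n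
  have "(1 - u) ^ 3 * (\<Sum>k<n. real ((k + 1) * (k + 2)) * u ^ k) = 2 - u ^ n * q n"
  proof (induction n)
    case (Suc n)
    have "(1 - u) ^ 3 * (\<Sum>k<Suc n. real ((k + 1) * (k + 2)) * u ^ k) =
        2 - u ^ n * q n + (1 - u) ^ 3 * (real ((n + 1) * (n + 2)) * u ^ n)"
      using Suc by (simp add: distrib_left)
    also have "\<dots> = 2 - u ^ n * (q n - (1 - u) ^ 3 * (real n + 1) * (real n + 2))"
      by (simp add: algebra_simps)
    also have "q n - (1 - u) ^ 3 * (real n + 1) * (real n + 2) = u * q (Suc n)"
      unfolding q_def by (simp add: power2_eq_square power3_eq_cube algebra_simps)
    finally show ?case by (simp add: mult_ac)
  qed (simp add: q_def)
  moreover have "q n \<ge> 0"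
  proof -
    \<comment> \<open>Regrouped so that every summand is visibly nonnegative for \<open>u\<close> in
      the unit interval.\<close>
    have "q n = (real n)\<^sup>2 * (1 - u)\<^sup>2 + real n * ((1 - u) * (3 - u)) + 2"
      by (simp add: q_def power2_eq_square algebra_simps)
    also have "\<dots> \<ge> 0"
      using assms by simp
    finally show ?thesis .
  qed
  ultimately show ?thesis
    using assms by simp
qed

section \<open>Newton's method near a point of small alpha\<close>

text \<open>Here \<open>A\<close> is the inverse of the Jacobian at \<open>x\<close> and \<open>g\<close> is Smale's gamma.\<close>

locale gamma_bound =
  fixes f :: "'n::finite polysys" and x :: "complex^'n" and A :: "complex^'n^'n" and g :: real
  assumes g_nonneg: "g \<ge> 0"
    and A_inverse: "A ** jacobian f x = mat 1"
    and deriv_bound: "\<And>vs. length vs \<ge> 2 \<Longrightarrow>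
      norm (A *v dir_deriv_sys vs f x) \<le> fact (length vs) * g ^ (length vs - 1) * (\<Prod>v\<leftarrow>vs. norm v)"
begin

text \<open>In the expansion at \<open>x\<close> the k-th term has \<open>k + 2\<close> directions,
  and (k+2)!/k! = (k+1)(k+2) produces the preceding series in \<open>u0\<close>.\<close>

lemma second_deriv_bound:
  assumes u: "g * norm (z - x) \<le> u" and "u < 1"
  shows "norm (A *v dir_deriv_sys [v, w] f z) \<le> 2 / (1 - u) ^ 3 * g * norm v * norm w"
proof -
  define h where "h = z - x"
  define u0 where "u0 = g * norm h"
  have u0: "0 \<le> u0" "u0 \<le> u" "u0 < 1"
    using assms g_nonneg by (auto simp: u0_def h_def)
  obtain n where n: "dir_deriv_sys [v, w] f (x + h) =
      (\<Sum>k\<le>n. (1 / fact k) *s dir_deriv_sys (replicate k h @ [v, w]) f x)"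
    using dir_deriv_sys_Taylor by blast
  have "A *v dir_deriv_sys [v, w] f z =
      (\<Sum>k\<le>n. (1 / fact k) *s (A *v dir_deriv_sys (replicate k h @ [v, w]) f x))"
    using n by (simp add: h_def matrix_vector_mult_sum_right vector_scalar_commute)
  also have "norm \<dots> \<le> (\<Sum>k\<le>n. real ((k + 1) * (k + 2)) * u0 ^ k * (g * norm v * norm w))"
  proof (rule sum_norm_le)
    fix k
    have "norm ((1 / fact k) *s (A *v dir_deriv_sys (replicate k h @ [v, w]) f x)) =
        norm (A *v dir_deriv_sys (replicate k h @ [v, w]) f x) / fact k"
      by (simp add: norm_vector_smult norm_divide)
    also have "\<dots> \<le> (fact (k + 2) * g ^ (k + 1) * (norm h ^ k * (norm v * norm w))) / fact k"
      using deriv_bound[of "replicate k h @ [v, w]"]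
      by (intro divide_right_mono) (simp_all add: map_replicate)
    also have "\<dots> = real ((k + 1) * (k + 2)) * u0 ^ k * (g * norm v * norm w)"
      by (simp add: u0_def power_mult_distrib field_simps)
    finally show "norm ((1 / fact k) *s (A *v dir_deriv_sys (replicate k h @ [v, w]) f x)) \<le> \<dots>" .
  qed
  also have "\<dots> = (\<Sum>k<Suc n. real ((k + 1) * (k + 2)) * u0 ^ k) * (g * norm v * norm w)"
    by (simp add: sum_distrib_right lessThan_Suc_atMost)
  also have "\<dots> \<le> 2 / (1 - u) ^ 3 * (g * norm v * norm w)"
  proof (rule mult_right_mono)
    have "(1 - u) ^ 3 * (\<Sum>k<Suc n. real ((k + 1) * (k + 2)) * u0 ^ k) \<le>
        (1 - u0) ^ 3 * (\<Sum>k<Suc n. real ((k + 1) * (k + 2)) * u0 ^ k)"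
      using u0 \<open>u < 1\<close> by (intro mult_right_mono power_mono sum_nonneg) auto
    also have "\<dots> \<le> 2"
      using u0 by (intro sum_binomial_series_le) auto
    finally show "(\<Sum>k<Suc n. real ((k + 1) * (k + 2)) * u0 ^ k) \<le> 2 / (1 - u) ^ 3"
      using \<open>u < 1\<close> by (simp add: pos_le_divide_eq mult.commute)
  qed (use g_nonneg in auto)
  finally show ?thesis by (simp add: mult.assoc)
qed

lemma second_deriv_bound_17:
  assumes "g * norm (z - x) \<le> 0.17"
  shows "norm (A *v dir_deriv_sys [v, w] f z) \<le> 3.5 * g * norm v * norm w"
proof -
  have "norm (A *v dir_deriv_sys [v, w] f z) \<le> 2 / (1 - 0.17) ^ 3 * (g * norm v * norm w)"
    using second_deriv_bound[OF assms, of v w] by (simp add: mult.assoc)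
  also have "\<dots> \<le> 3.5 * (g * norm v * norm w)"
    using g_nonneg by (intro mult_right_mono) (auto simp: field_simps)
  finally show ?thesis by (simp add: mult.assoc)
qed

text \<open>\<open>A\<close> times the Jacobian is the identity at \<open>x\<close>; along the
  segment to \<open>z\<close> it changes by at most 3.5 * 0.17 = 0.595.\<close>

lemma jacobian_near_identity:
  assumes z: "g * norm (z - x) \<le> 0.17"
  shows "norm (A *v (jacobian f z *v w) - w) \<le> 0.595 * norm w"
proof -
  let ?\<phi> = "\<lambda>t. A *v dir_deriv_sys [w] f (x + t *\<^sub>R (z - x))"
  have "norm (?\<phi> 1 - ?\<phi> 0) \<le> 3.5 * g * norm (z - x) * norm w * 1 ^ Suc 0"
  proof (rule norm_increment_le)
    fix t :: real
    assume t: "0 \<le> t" "t \<le> 1"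
    have "g * norm (x + t *\<^sub>R (z - x) - x) = t * (g * norm (z - x))"
      using t by simp
    also have "\<dots> \<le> 1 * (g * norm (z - x))"
      using t g_nonneg by (intro mult_right_mono) auto
    finally show "norm (A *v dir_deriv_sys [z - x, w] f (x + t *\<^sub>R (z - x))) \<le>
        3.5 * g * norm (z - x) * norm w * real (Suc 0) * t ^ 0"
      using second_deriv_bound_17[of "x + t *\<^sub>R (z - x)" "z - x" w] z by simp
  qed (auto intro: has_vector_derivative_dir_deriv_sys_line)
  also have "\<dots> = 3.5 * (g * norm (z - x)) * norm w"
    by simp
  also have "\<dots> \<le> 3.5 * 0.17 * norm w"
    using z by (intro mult_right_mono mult_left_mono) auto
  finally show ?thesis
    by (simp add: dir_deriv_sys_single matrix_vector_mul_assoc A_inverse)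
qed

text \<open>As 0.595 < 1, a kernel vector would be shorter than itself unless it is 0.\<close>

lemma invertible_jacobian:
  assumes z: "g * norm (z - x) \<le> 0.17"
  shows "invertible (jacobian f z)"
proof -
  have "w = 0" if "jacobian f z *v w = 0" for w
    using jacobian_near_identity[OF z, of w] that by simp
  then show ?thesis
    unfolding invertible_left_inverse matrix_left_invertible_ker by blast
qed

lemma second_order_Taylor_bound:
  assumes z: "g * norm (z - x) \<le> 0.17" and y: "g * norm (y - x) \<le> 0.17"
  shows "norm (A *v (eval_sys f y - eval_sys f z - jacobian f z *v (y - z))) \<le>
    1.75 * g * (norm (y - z))\<^sup>2"
proof -
  define d where "d = y - z"
  let ?p = "\<lambda>t. z + t *\<^sub>R d"
  let ?\<phi> = "\<lambda>t. A *v dir_deriv_sys [] f (?p t)" and ?\<phi>' = "\<lambda>t. A *v dir_deriv_sys [d] f (?p t)"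
  have near: "g * norm (?p t - x) \<le> 0.17" if t: "0 \<le> t" "t \<le> 1" for t
  proof -
    have "?p t - x = (1 - t) *\<^sub>R (z - x) + t *\<^sub>R (y - x)"
      by (simp add: d_def algebra_simps)
    then have "norm (?p t - x) \<le> (1 - t) * norm (z - x) + t * norm (y - x)"
      using norm_triangle_ineq[of "(1 - t) *\<^sub>R (z - x)" "t *\<^sub>R (y - x)"] t by simp
    then have "g * norm (?p t - x) \<le> g * ((1 - t) * norm (z - x) + t * norm (y - x))"
      using g_nonneg by (rule mult_left_mono)
    also have "\<dots> = (1 - t) * (g * norm (z - x)) + t * (g * norm (y - x))"
      by (simp add: algebra_simps)
    also have "\<dots> \<le> (1 - t) * 0.17 + t * 0.17"
      using z y t by (intro add_mono mult_left_mono) auto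
    also have "\<dots> = 0.17"
      by (simp add: field_simps)
    finally show ?thesis .
  qed
  have first: "norm (?\<phi>' t - ?\<phi>' 0) \<le> 1.75 * g * (norm d)\<^sup>2 * real (Suc 1) * t ^ 1"
    if t: "0 \<le> t" "t \<le> 1" for t
  proof -
    have "norm (?\<phi>' t - ?\<phi>' 0) \<le> 3.5 * g * norm d * norm d * t ^ Suc 0"
    proof (rule norm_increment_le)
      fix s :: real
      assume "0 \<le> s" "s \<le> t"
      then show "norm (A *v dir_deriv_sys [d, d] f (?p s)) \<le>
          3.5 * g * norm d * norm d * real (Suc 0) * s ^ 0"
        using second_deriv_bound_17[OF near, of s d d] t by simp
    qed (use t in \<open>auto intro: has_vector_derivative_dir_deriv_sys_line\<close>)
    then show ?thesis by (simp add: power2_eq_square mult_ac)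
  qed
  \<comment> \<open>Removing the linear part leaves the derivative
    \<open>?\<phi>' t - ?\<phi>' 0\<close>, of order \<open>t\<close>; integration then halves 3.5
    to 1.75.\<close>
  have "norm ((?\<phi> 1 - 1 *\<^sub>R ?\<phi>' 0) - (?\<phi> 0 - 0 *\<^sub>R ?\<phi>' 0)) \<le> 1.75 * g * (norm d)\<^sup>2 * 1 ^ Suc 1"
  proof (rule norm_increment_le[where \<phi>' = "\<lambda>t. ?\<phi>' t - ?\<phi>' 0"])
    show "((\<lambda>t. ?\<phi> t - t *\<^sub>R ?\<phi>' 0) has_vector_derivative ?\<phi>' t - ?\<phi>' 0) (at t)" for t
      by (intro has_vector_derivative_diff has_vector_derivative_dir_deriv_sys_line)
        (auto intro!: derivative_eq_intros)
  qed (use first in auto)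
  then show ?thesis
    by (simp add: d_def dir_deriv_sys_Nil dir_deriv_sys_single matrix_vector_mult_diff_distrib
        algebra_simps)
qed

text \<open>The Jacobian at \<open>z\<close> sends the new error to the Taylor remainder of
  \<open>f\<close> at \<xi>. Multiplied by \<open>A\<close> it is within 0.595 of the identity, so
  it shrinks a vector at most to 0.405 of its length.\<close>

lemma newton_quadratic:
  assumes z: "g * norm (z - x) \<le> 0.17" and \<xi>: "g * norm (\<xi> - x) \<le> 0.17" "\<xi> \<in> zero_set f"
  shows "0.405 * norm (newton f z - \<xi>) \<le> 1.75 * g * (norm (z - \<xi>))\<^sup>2"
proof -
  let ?J = "jacobian f z" and ?v = "newton f z - \<xi>"
  have inv: "invertible ?J"
    using invertible_jacobian[OF z] .
  then have "?J ** matrix_inv ?J = mat 1"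
    unfolding invertible_def matrix_inv_def by (rule someI2_ex) auto
  then have "?J *v (z - newton f z) = eval_sys f z"
    using inv by (simp add: newton_def matrix_vector_mul_assoc)
  then have "?J *v ?v = eval_sys f \<xi> - eval_sys f z - ?J *v (\<xi> - z)"
    using \<xi>(2) by (simp add: zero_set_def matrix_vector_mult_diff_distrib algebra_simps)
  then have "norm (A *v (?J *v ?v)) \<le> 1.75 * g * (norm (z - \<xi>))\<^sup>2"
    using second_order_Taylor_bound[OF z \<xi>(1)] by (simp add: norm_minus_commute)
  moreover have "norm ?v - norm (A *v (?J *v ?v) - ?v) \<le> norm (A *v (?J *v ?v))"
    by (metis norm_minus_commute norm_triangle_ineq2 norm_triangle_sub diff_le_eq add.commute)
  ultimately show ?thesis
    using jacobian_near_identity[OF z, of ?v] by simp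
qed

lemma approx_solution_near:
  assumes \<xi>: "g * norm (\<xi> - x) \<le> 0.06" "\<xi> \<in> zero_set f" and y: "g * norm (y - x) \<le> 0.05"
  shows "approx_solution f y \<xi>"
proof -
  define e where "e = norm (y - \<xi>)"
  have e_nonneg: "e \<ge> 0" by (simp add: e_def)
  have "g * e \<le> g * (norm (y - x) + norm (\<xi> - x))"
    unfolding e_def using g_nonneg norm_triangle_ineq4[of "y - x" "\<xi> - x"]
    by (intro mult_left_mono) auto
  then have ge: "g * e \<le> 0.11"
    using \<xi>(1) y by (simp add: distrib_left)
  have "norm ((newton f ^^ k) y - \<xi>) \<le> (1/2) ^ (2 ^ k - 1) * e" for k
  proof (induction k)
    case 0
    show ?case by (simp add: e_def)
  next
    case (Suc k)
    define z where "z = (newton f ^^ k) y"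
    define q :: real where "q = (1/2) ^ (2 ^ k - 1)"
    have q: "0 \<le> q" "q \<le> 1"
      by (auto simp: q_def intro: power_le_one)
    have zq: "norm (z - \<xi>) \<le> q * e"
      using Suc by (simp add: z_def q_def)
    \<comment> \<open>The iterate is no farther from \<xi> than the start, which keeps it in the
      ball of radius 0.17.\<close>
    also have "\<dots> \<le> e"
      using q e_nonneg by (simp add: mult_left_le_one_le)
    finally have "g * norm (z - \<xi>) \<le> g * e"
      using g_nonneg by (rule mult_left_mono)
    moreover have "g * norm (z - x) \<le> g * (norm (z - \<xi>) + norm (\<xi> - x))"
      using g_nonneg norm_triangle_ineq[of "z - \<xi>" "\<xi> - x"] by (intro mult_left_mono) auto
    ultimately have near: "g * norm (z - x) \<le> 0.17"
      using ge \<xi>(1) by (simp add: distrib_left)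
    have "0.405 * norm (newton f z - \<xi>) \<le> 1.75 * g * (norm (z - \<xi>))\<^sup>2"
      using near \<xi> by (intro newton_quadratic) auto
    also have "\<dots> \<le> 1.75 * g * (q * e)\<^sup>2"
      using zq g_nonneg by (intro mult_left_mono power_mono) auto
    also have "\<dots> = 1.75 * (g * e) * (q\<^sup>2 * e)"
      by (simp add: power2_eq_square)
    also have "\<dots> \<le> 1.75 * 0.11 * (q\<^sup>2 * e)"
      using ge e_nonneg by (intro mult_right_mono mult_left_mono) auto
    \<comment> \<open>1.75 * 0.11 = 0.1925 is below 0.405 / 2 = 0.2025.\<close>
    also have "\<dots> \<le> 0.405 * (1/2 * (q\<^sup>2 * e))"
      using e_nonneg by simp
    finally have "norm (newton f z - \<xi>) \<le> 1/2 * q\<^sup>2 * e"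
      by (simp add: mult.commute)
    moreover have "1/2 * q\<^sup>2 = (1/2) ^ (2 ^ Suc k - 1)"
    proof -
      \<comment> \<open>Writing the power as a successor controls the truncated subtraction in the
        exponent: 2 (2^k - 1) + 1 = 2^(k+1) - 1.\<close>
      obtain m where "(2::nat) ^ k = Suc m"
        using not0_implies_Suc[of "2 ^ k"] by auto
      then have "2 ^ Suc k - 1 = Suc ((2 ^ k - 1) * 2)"
        by simp
      then show ?thesis
        by (simp only: q_def power_mult power_Suc)
    qed
    ultimately show ?case
      by (simp add: z_def)
  qed
  then show ?thesis
    using \<xi>(2) by (simp add: approx_solution_def e_def)
qed

text \<open>A zero is fixed by Newton's map, so quadratic contraction towards \<xi> bounds its
  distance by a strictly smaller multiple of itself: 1.75 * 0.22 = 0.385 < 0.405.\<close>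

lemma zero_unique_near:
  assumes \<xi>: "g * norm (\<xi> - x) \<le> 0.17" "\<xi> \<in> zero_set f"
    and \<eta>: "g * norm (\<eta> - x) \<le> 0.17" "\<eta> \<in> zero_set f"
    and near: "g * norm (\<eta> - \<xi>) \<le> 0.22"
  shows "\<eta> = \<xi>"
proof -
  have "newton f \<eta> = \<eta>"
    using \<eta>(2) by (simp add: newton_def zero_set_def)
  then have "0.405 * norm (\<eta> - \<xi>) \<le> 1.75 * (g * norm (\<eta> - \<xi>)) * norm (\<eta> - \<xi>)"
    using newton_quadratic[OF \<eta>(1) \<xi>] by (simp add: power2_eq_square)
  also have "\<dots> \<le> 1.75 * 0.22 * norm (\<eta> - \<xi>)"
    using near by (intro mult_right_mono mult_left_mono) auto
  finally show ?thesis by simp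
qed

end

section \<open>Real systems\<close>

lemma eval_poly_cnj: "eval_poly (cnj_poly p) (cnj_vec x) = cnj (eval_poly p x)"
proof -
  have lookup: "Poly_Mapping.lookup (cnj_poly p) m = cnj (Poly_Mapping.lookup p m)" for m
    by (simp add: cnj_poly_def Poly_Mapping.map.rep_eq when_def)
  then have "Poly_Mapping.keys (cnj_poly p) = Poly_Mapping.keys p"
    by (auto simp: in_keys_iff)
  then show ?thesis
    by (simp add: eval_poly_def lookup cnj_vec_def)
qed

text \<open>Conjugation may permute the components, so each one is the conjugate of some other,
  possibly different, component, which also vanishes at \<xi>.\<close>

lemma cnj_vec_zero_set:
  assumes "real_sys f" "\<xi> \<in> zero_set f"
  shows "cnj_vec \<xi> \<in> zero_set f"
proof -
  have "eval_poly (f $ i) (cnj_vec \<xi>) = 0" for i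
  proof -
    have "f $ i \<in> range (\<lambda>i. cnj_poly (f $ i))"
      using assms(1) by (simp add: real_sys_def)
    then obtain j where "f $ i = cnj_poly (f $ j)" by blast
    moreover have "eval_poly (f $ j) \<xi> = 0"
      using assms(2) by (auto simp: zero_set_def eval_sys_def vec_eq_iff)
    ultimately show ?thesis by (simp add: eval_poly_cnj)
  qed
  then show ?thesis
    by (simp add: zero_set_def eval_sys_def vec_eq_iff)
qed

lemma real_points_iff: "x \<in> real_points \<longleftrightarrow> cnj_vec x = x"
  by (simp add: real_points_def cnj_vec_def vec_eq_iff Reals_cnj_iff)

lemma norm_cnj_vec_diff: "norm (cnj_vec x - cnj_vec y) = norm (x - y)"
proof -
  have "cmod (cnj (x $ i) - cnj (y $ i)) = cmod (x $ i - y $ i)" for i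
    by (metis complex_cnj_diff complex_mod_cnj)
  then have "(norm (cnj_vec x - cnj_vec y))\<^sup>2 = (norm (x - y))\<^sup>2"
    by (simp add: norm_vec_sq cnj_vec_def)
  then show ?thesis by simp
qed

lemma diff_proj_real: "x - proj_real x = (1/2) *s (x - cnj_vec x)"
  by (simp add: proj_real_def vec_eq_iff field_simps)

lemma norm_cnj_vec_self: "norm (cnj_vec x - x) = 2 * norm (x - proj_real x)"
  unfolding diff_proj_real norm_vector_smult norm_minus_commute[of "cnj_vec x"] by simp

text \<open>Conjugation is an isometry fixing a real \<xi>, so \<open>x\<close> and its conjugate
  are equally far from \<xi>, and \<open>x - proj_real x\<close> is half their difference.\<close>

lemma norm_proj_real_le:
  assumes "\<xi> \<in> real_points"
  shows "norm (x - proj_real x) \<le> norm (x - \<xi>)"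
proof -
  have "2 * norm (x - proj_real x) \<le> norm (cnj_vec x - \<xi>) + norm (x - \<xi>)"
    unfolding norm_cnj_vec_self[symmetric]
    using norm_triangle_ineq4[of "cnj_vec x - \<xi>" "x - \<xi>"] by simp
  also have "norm (cnj_vec x - \<xi>) = norm (x - \<xi>)"
    using assms norm_cnj_vec_diff[of x \<xi>] by (simp add: real_points_iff)
  finally show ?thesis by simp
qed

section \<open>The certification theorem\<close>

text \<open>The case \<open>k = 1\<close> says that one Newton step, of length beta, at least halves
  the distance to \<xi>. At a singular Jacobian the step is trivial, which forces \<open>x\<close> =
  \<xi>.\<close>

lemma approx_solution_dist_le_beta:
  assumes "approx_solution f x \<xi>"
  shows "ennreal (norm (x - \<xi>)) \<le> 2 * beta f x"
proof -
  have "norm ((newton f ^^ 1) x - \<xi>) \<le> (1/2) ^ (2 ^ 1 - 1) * norm (x - \<xi>)"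
    using assms unfolding approx_solution_def by blast
  then have half: "norm (newton f x - \<xi>) \<le> 1/2 * norm (x - \<xi>)"
    by simp
  show ?thesis
  proof (cases "invertible (jacobian f x)")
    case True
    have "norm (x - \<xi>) \<le> norm (x - newton f x) + norm (newton f x - \<xi>)"
      using norm_triangle_ineq[of "x - newton f x" "newton f x - \<xi>"] by simp
    then have "norm (x - \<xi>) \<le> 2 * norm (x - newton f x)"
      using half by simp
    then have "ennreal (norm (x - \<xi>)) \<le> ennreal (2 * norm (x - newton f x))"
      by (rule ennreal_leI)
    then show ?thesis
      using True by (simp add: newton_def beta_def ennreal_mult)
  next
    case False
    then have "norm (x - \<xi>) = 0"
      using half by (simp add: newton_def)
    then show ?thesis by simp
  qed
qed

lemma gamma_bound_of_gamma:
  fixes f :: "'n::finite polysys"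
  assumes inv: "invertible (jacobian f x)" and g: "gamma f x = ennreal g" "g \<ge> 0"
  shows "gamma_bound f x (matrix_inv (jacobian f x)) g"
proof
  let ?A = "matrix_inv (jacobian f x)"
  show "?A ** jacobian f x = mat 1"
    using inv unfolding invertible_def matrix_inv_def by (rule someI2_ex) auto
  fix vs :: "(complex^'n) list"
  assume vs: "length vs \<ge> 2"
  define k where "k = length vs"
  let ?s = "sym_onorm k (\<lambda>L. (1 / fact k) *s (?A *v deriv_tensor f k x L))"
  have "ennreal (root (k - 1) ?s) \<le> gamma f x"
    using inv vs by (auto simp: gamma_def k_def intro!: SUP_upper)
  then have root: "root (k - 1) ?s \<le> g"
    using g by (simp add: ennreal_le_iff)
  \<comment> \<open>Taking the power inverts \<open>root\<close> on nonnegative values; a negative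
    value would satisfy the bound at once.\<close>
  have s: "?s \<le> g ^ (k - 1)"
  proof (cases "?s \<ge> 0")
    case True
    then have "?s = root (k - 1) ?s ^ (k - 1)"
      using vs by (simp add: k_def)
    also have "\<dots> \<le> g ^ (k - 1)"
      using root True vs by (intro power_mono real_root_ge_zero) (auto simp: k_def)
    finally show ?thesis .
  next
    case False
    moreover have "0 \<le> g ^ (k - 1)" using g(2) by simp
    ultimately show ?thesis by linarith
  qed
  have prod: "0 \<le> (\<Prod>v\<leftarrow>vs. norm v)"
    by (induction vs) auto
  have "norm ((1 / fact k) *s (?A *v dir_deriv_sys vs f x)) \<le> ?s * (\<Prod>v\<leftarrow>vs. norm v)"
    by (rule norm_dir_deriv_sys_le) (simp add: k_def)
  also have "\<dots> \<le> g ^ (k - 1) * (\<Prod>v\<leftarrow>vs. norm v)"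
    using s prod by (rule mult_right_mono)
  finally show "norm (?A *v dir_deriv_sys vs f x) \<le>
      fact (length vs) * g ^ (length vs - 1) * (\<Prod>v\<leftarrow>vs. norm v)"
    by (simp add: norm_vector_smult norm_divide k_def field_simps)
qed (fact g)

theorem mainTheorem2:
  fixes f :: "'n::finite polysys" and x \<xi> :: "complex^'n"
  assumes "real_sys f"
    and "approx_solution f x \<xi>"
  shows "(ennreal (norm (x - proj_real x)) > 2 * beta f x \<longrightarrow> \<xi> \<notin> real_points) \<and>
         (alpha f x < ennreal 0.03 \<and>
          ennreal (norm (x - proj_real x)) < 1 / (20 * gamma f x) \<longrightarrow>
            approx_solution f (proj_real x) \<xi> \<and> \<xi> \<in> real_points)"
proof (intro conjI[of "_ \<longrightarrow> _" "_ \<longrightarrow> _"] impI)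
  note dist = approx_solution_dist_le_beta[OF assms(2)]
  {
    assume "2 * beta f x < ennreal (norm (x - proj_real x))"
    with dist have "ennreal (norm (x - \<xi>)) < ennreal (norm (x - proj_real x))"
      by (rule le_less_trans)
    then have "norm (x - \<xi>) < norm (x - proj_real x)"
      by (simp add: ennreal_less_iff)
    then show "\<xi> \<notin> real_points"
      using norm_proj_real_le[of \<xi> x] by force
  }
  assume hyp: "alpha f x < ennreal 0.03 \<and> ennreal (norm (x - proj_real x)) < 1 / (20 * gamma f x)"
  \<comment> \<open>Infinite gamma would make the strict bound 1 / \<infinity> = 0. This also
    excludes a singular Jacobian.\<close>
  have "gamma f x \<noteq> \<infinity>"
    using hyp by (auto simp: ennreal_mult_top)
  then obtain g where g: "gamma f x = ennreal g" "g \<ge> 0"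
    by (cases "gamma f x") auto
  have inv: "invertible (jacobian f x)"
    using \<open>gamma f x \<noteq> \<infinity>\<close> by (rule contrapos_np) (simp add: gamma_def)
  define b where "b = norm (matrix_inv (jacobian f x) *v eval_sys f x)"
  have b: "beta f x = ennreal b" "b \<ge> 0"
    using inv by (auto simp: beta_def b_def)
  interpret gamma_bound f x "matrix_inv (jacobian f x)" g
    using inv g by (rule gamma_bound_of_gamma)
  have "alpha f x = ennreal (b * g)"
    using inv b g by (simp add: alpha_def ennreal_mult)
  then have bg: "b * g < 0.03"
    using hyp b g by (simp add: ennreal_less_iff)
  have "ennreal (norm (x - \<xi>)) \<le> ennreal (2 * b)"
    using dist b by (simp add: ennreal_mult)
  then have "norm (x - \<xi>) \<le> 2 * b"
    using b by (simp add: ennreal_le_iff)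
  then have "g * norm (x - \<xi>) \<le> g * (2 * b)"
    using g(2) by (rule mult_left_mono)
  with bg have \<xi>_near: "g * norm (\<xi> - x) \<le> 0.06"
    by (simp add: norm_minus_commute mult_ac)
  have proj_near: "g * norm (x - proj_real x) \<le> 0.05"
  \<comment> \<open>For \<open>g = 0\<close> the hypothesis reads \<open>< \<infinity>\<close> and
    carries no information, but the scaled distance is 0.\<close>
  proof (cases "g = 0")
    case False
    with g have pos: "g > 0" by simp
    have "1 / (20 * gamma f x) = ennreal (1 / (20 * g))"
      using divide_ennreal[of 1 "20 * g"] pos by (simp add: g(1) ennreal_mult)
    then have "norm (x - proj_real x) < 1 / (20 * g)"
      using hyp pos by (simp add: ennreal_less_iff)
    then show ?thesis
      using pos by (simp add: field_simps)
  qed simp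
  have zero: "\<xi> \<in> zero_set f"
    using assms(2) by (simp add: approx_solution_def)
  have "approx_solution f (proj_real x) \<xi>"
    using \<xi>_near zero proj_near by (intro approx_solution_near) (simp_all add: norm_minus_commute)
  moreover have "cnj_vec \<xi> = \<xi>"
  proof (rule zero_unique_near)
    have "norm (cnj_vec \<xi> - x) \<le> norm (cnj_vec \<xi> - cnj_vec x) + norm (cnj_vec x - x)"
      using norm_triangle_ineq[of "cnj_vec \<xi> - cnj_vec x" "cnj_vec x - x"] by simp
    also have "\<dots> = norm (\<xi> - x) + 2 * norm (x - proj_real x)"
      by (simp add: norm_cnj_vec_diff norm_cnj_vec_self)
    finally have "g * norm (cnj_vec \<xi> - x) \<le> g * (norm (\<xi> - x) + 2 * norm (x - proj_real x))"
      using g(2) by (rule mult_left_mono)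
    \<comment> \<open>0.06 + 2 * 0.05 = 0.16; conjugating \<open>x\<close> moves it by twice its
      distance to the projection.\<close>
    then have near: "g * norm (cnj_vec \<xi> - x) \<le> 0.16"
      using \<xi>_near proj_near by (simp add: distrib_left)
    then show "g * norm (cnj_vec \<xi> - x) \<le> 0.17" by simp
    have "g * norm (cnj_vec \<xi> - \<xi>) \<le> g * (norm (cnj_vec \<xi> - x) + norm (\<xi> - x))"
      using g(2) norm_triangle_ineq4[of "cnj_vec \<xi> - x" "\<xi> - x"] by (intro mult_left_mono) auto
    \<comment> \<open>0.16 + 0.06 = 0.22.\<close>
    then show "g * norm (cnj_vec \<xi> - \<xi>) \<le> 0.22"
      using near \<xi>_near by (simp add: distrib_left)
    show "cnj_vec \<xi> \<in> zero_set f"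
      using assms(1) zero by (rule cnj_vec_zero_set)
  qed (use \<xi>_near zero in auto)
  ultimately show "approx_solution f (proj_real x) \<xi> \<and> \<xi> \<in> real_points"
    by (simp add: real_points_iff)
qed

end
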